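(* Let $p<q$ be two prime numbers, $N=pq$ and $q=p+s$ with $1\leq s\leq p-1$. Then $$\mathbb{Z}\text{-}\mathcal{KS}(N)= \left( \bigcup_{d_{q}\mid q-1,\ \varepsilon\in\{-1,1\}} \left\{p+\varepsilon d_{q} \, ; \, s-\varepsilon d_{q}\mid p-1 \right\}\right)\cup\{2p \, ; \; p-s\mid p-1\},$$ where $d_q$ ranges over the positive divisors of $q-1$, and $\{x\,;\,P\}$ denotes $\{x\}$ if the condition $P$ holds and $\emptyset$ otherwise.
   Context: For an integer $N\geq 2$, the set $\mathbb{Z}\text{-}\mathcal{KS}(N)$ (the $\mathbb{Z}$-Korselt set of $N$) is the set of all $\alpha\in\mathbb{Z}\setminus\{0,N\}$ such that $\ell-\alpha$ divides $N-\alpha$ (in $\mathbb{Z}$) for every prime divisor $\ell$ of $N$. *)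

theory Defs
  imports "HOL-Computational_Algebra.Primes"
begin

(* On type int, a prime is required to be positive, so l ranges over the
   ordinary (positive) prime divisors of N. The notion is meant for N >= 2. *)
definition Z_Korselt_set :: "int \<Rightarrow> int set" where
  "Z_Korselt_set N =
     {\<alpha>. \<alpha> \<notin> {0, N} \<and> (\<forall>l. prime l \<and> l dvd N \<longrightarrow> l - \<alpha> dvd N - \<alpha>)}"

end

theory Submission
  imports Defs
begin

text \<open>
  Reducing \<open>p q - \<alpha>\<close> modulo \<open>p - \<alpha>\<close> and modulo \<open>q - \<alpha>\<close> turns membership of \<open>\<alpha>\<close> in the Korselt
  set of \<open>p q\<close> into the two conditions \<open>p - \<alpha> dvd p (q - 1)\<close> and \<open>q - \<alpha> dvd q (p - 1)\<close>.  The
  theorem amounts to removing the prime factors \<open>q\<close> and \<open>p\<close> on the right.  A divisor of a prime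
  times \<open>m\<close> either divides \<open>m\<close> or is a multiple of that prime, and a multiple is usually too
  large for the other condition.

  The factor \<open>q\<close> can always be removed (\<open>q_minus_korselt_dvd\<close>): otherwise \<open>\<alpha>\<close> is a multiple of
  \<open>q\<close>, and \<open>p - \<alpha>\<close> is coprime to \<open>p\<close> but larger than \<open>q - 1\<close> in absolute value.  With
  \<open>q - \<alpha> dvd p - 1\<close> established, \<open>\<alpha>\<close> is at distance less than \<open>p\<close> from \<open>q\<close>.  If the factor \<open>p\<close>
  cannot be removed, then \<open>\<alpha>\<close> is a multiple of \<open>p\<close>, and the bounds \<open>p < q < 2 p\<close> leave only
  \<open>\<alpha> = 2 p\<close> (\<open>p_minus_korselt_dvd\<close>).  Writing \<open>\<alpha> = p + \<epsilon> d\<close> gives the asserted form.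
\<close>

lemma dvd_prime_mult_cases:
  fixes p d m :: int
  assumes "prime p" and "d dvd p * m"
  shows "d dvd m \<or> p dvd d"
proof (cases "p dvd d")
  case False
  with assms have "coprime d p"
    using prime_imp_coprime coprime_commute by blast
  with assms show ?thesis
    by (simp add: coprime_dvd_mult_right_iff)
qed simp

lemma Z_Korselt_set_semiprime_iff:
  fixes p q \<alpha> :: int
  assumes p: "prime p" and q: "prime q"
  shows "\<alpha> \<in> Z_Korselt_set (p * q) \<longleftrightarrow>
    \<alpha> \<noteq> 0 \<and> \<alpha> \<noteq> p * q \<and> p - \<alpha> dvd p * (q - 1) \<and> q - \<alpha> dvd q * (p - 1)"
proof -
  have primes: "prime l \<and> l dvd p * q \<longleftrightarrow> l = p \<or> l = q" for l
    using p q by (auto simp: prime_dvd_mult_iff primes_dvd_imp_eq)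
  have P: "p * q - \<alpha> = p * (q - 1) + (p - \<alpha>)" and Q: "p * q - \<alpha> = q * (p - 1) + (q - \<alpha>)"
    by (simp_all add: algebra_simps)
  have "p - \<alpha> dvd p * q - \<alpha> \<longleftrightarrow> p - \<alpha> dvd p * (q - 1)"
    unfolding P by (simp add: dvd_add_left_iff)
  moreover have "q - \<alpha> dvd p * q - \<alpha> \<longleftrightarrow> q - \<alpha> dvd q * (p - 1)"
    unfolding Q by (simp add: dvd_add_left_iff)
  ultimately show ?thesis
    unfolding Z_Korselt_set_def by (auto simp: primes)
qed

text \<open>
  If the conclusion fails, then \<open>q - \<alpha> = q k\<close> with \<open>k dvd p - 1\<close>, so \<open>\<alpha> = q (1 - k)\<close> with \<open>k\<close>
  of absolute value less than \<open>p\<close>.  The excluded values \<open>\<alpha> = 0\<close> and \<open>\<alpha> = p q\<close> are exactly those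
  with \<open>p dvd k - 1\<close>; for the others \<open>p - \<alpha>\<close> must divide \<open>q - 1\<close>, although its absolute value
  exceeds \<open>q - 1\<close>.
\<close>

lemma q_minus_korselt_dvd:
  fixes p q \<alpha> :: int
  assumes p: "prime p" and q: "prime q" and less: "p < q"
    and \<alpha>: "\<alpha> \<noteq> 0" "\<alpha> \<noteq> p * q"
    and dvd_p: "p - \<alpha> dvd p * (q - 1)" and dvd_q: "q - \<alpha> dvd q * (p - 1)"
  shows "q - \<alpha> dvd p - 1"
proof (rule ccontr)
  assume "\<not> q - \<alpha> dvd p - 1"
  with dvd_prime_mult_cases[OF q dvd_q] obtain k where k: "q - \<alpha> = q * k"
    by (auto elim: dvdE)
  have p1: "p > 1" and q0: "q > 0"
    using p q by (simp_all add: prime_gt_1_int prime_gt_0_int)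
  have kdvd: "k dvd p - 1"
    using dvd_q q0 unfolding k by simp
  have kbound: "\<bar>k\<bar> \<le> p - 1"
    using dvd_imp_le_int[OF _ kdvd] p1 by simp
  have k0: "k \<noteq> 0"
    using kdvd p1 by auto
  have \<alpha>_eq: "\<alpha> = q * (1 - k)"
    using k by (simp add: algebra_simps)
  have k1: "k \<noteq> 1"
    using \<alpha>(1) \<alpha>_eq by auto
  have kp: "k \<noteq> 1 - p"
    using \<alpha>(2) \<alpha>_eq by auto
  have "\<not> p dvd k - 1"
  proof
    assume dvd: "p dvd k - 1"
    show False
    proof (cases "k > 1")
      case True
      then show False
        using zdvd_imp_le[OF dvd] kbound by simp
    next
      case False
      have "p dvd 1 - k"
        using dvd by (simp add: dvd_diff_commute)
      then have "p dvd (1 - k) - p"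
        by simp
      moreover have "1 - k - p \<noteq> 0" "\<bar>1 - k - p\<bar> < p"
        using False k1 kp kbound by auto
      ultimately show False
        using dvd_imp_le_int[of "1 - k - p" p] p1 by simp
    qed
  qed
  moreover have "\<not> p dvd q"
    using p q less primes_dvd_imp_eq by blast
  ultimately have "\<not> p dvd \<alpha>"
    using p unfolding \<alpha>_eq by (simp add: prime_dvd_mult_iff dvd_diff_commute)
  then have "\<not> p dvd p - \<alpha>"
    by (metis diff_diff_eq2 dvd_diff dvd_refl add_diff_cancel_left')
  with dvd_prime_mult_cases[OF p dvd_p] have "p - \<alpha> dvd q - 1"
    by blast
  then have small: "\<bar>p - \<alpha>\<bar> \<le> q - 1"
    using dvd_imp_le_int[of "q - 1" "p - \<alpha>"] less p1 by simp
  consider "k \<ge> 2" | "k \<le> -1"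
    using k0 k1 by linarith
  then show False
  proof cases
    case 1
    then have "q * 2 \<le> q * k"
      using q0 by simp
    then show False
      using small k p1 by simp
  next
    case 2
    then have "q * k \<le> q * (-1)"
      using q0 by (intro mult_left_mono) simp_all
    then show False
      using small k less by simp
  qed
qed

text \<open>
  The interval of radius \<open>p - 1\<close> around \<open>q\<close> lies strictly between \<open>0\<close> and \<open>3 p\<close>, so the only
  multiples of \<open>p\<close> that it can contain are \<open>p\<close> and \<open>2 p\<close>; the former would make \<open>p - \<alpha>\<close> zero.
\<close>

lemma p_minus_korselt_dvd:
  fixes p q \<alpha> :: int
  assumes p: "prime p" and bounds: "p < q" "q < 2 * p"
    and dvd_p: "p - \<alpha> dvd p * (q - 1)" and dvd_q: "q - \<alpha> dvd p - 1"
    and \<alpha>: "\<alpha> \<noteq> 2 * p"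
  shows "p - \<alpha> dvd q - 1"
proof (rule ccontr)
  assume "\<not> p - \<alpha> dvd q - 1"
  with dvd_prime_mult_cases[OF p dvd_p] have "p dvd p - \<alpha>"
    by blast
  then have "p dvd p - (p - \<alpha>)"
    by (rule dvd_diff[OF dvd_refl])
  then obtain m where m: "\<alpha> = p * m"
    by (auto elim: dvdE)
  have p1: "p > 1"
    using p by (simp add: prime_gt_1_int)
  have near: "\<bar>q - \<alpha>\<bar> \<le> p - 1"
    using dvd_imp_le_int[OF _ dvd_q] p1 by simp
  have "m \<noteq> 1"
    using dvd_p p1 bounds unfolding m by auto
  moreover have "m \<noteq> 2"
    using \<alpha> m by auto
  ultimately consider "m \<le> 0" | "m \<ge> 3"
    by linarith
  then show False
  proof cases
    case 1
    then have "\<alpha> \<le> 0"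
      using p1 m by (simp add: mult_nonneg_nonpos)
    then show False
      using near bounds by simp
  next
    case 2
    then have "p * 3 \<le> \<alpha>"
      using p1 m by simp
    then show False
      using near bounds by simp
  qed
qed

theorem theorem3p2:
  fixes p q N s :: int
  assumes "prime p" and "prime q" and "p < q"
    and "N = p * q" and "q = p + s" and "1 \<le> s" and "s \<le> p - 1"
  shows "Z_Korselt_set N =
    (\<Union>d \<in> {d. d > 0 \<and> d dvd q - 1}. \<Union>\<epsilon> \<in> {-1, 1}.
        if s - \<epsilon> * d dvd p - 1 then {p + \<epsilon> * d} else {})
    \<union> (if p - s dvd p - 1 then {2 * p} else {})" (is "_ = ?R")
proof -
  have p1: "p > 1"
    using assms(1) by (simp add: prime_gt_1_int)
  have s: "s = q - p"
    using assms(5) by simp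
  \<comment> \<open>The pair \<open>(\<epsilon>, d)\<close> is the sign and absolute value of \<open>\<alpha> - p\<close>, and \<open>\<alpha> \<noteq> p\<close> follows
      from \<open>q - 1 \<noteq> 0\<close>.\<close>
  have R: "\<alpha> \<in> ?R \<longleftrightarrow> (p - \<alpha> dvd q - 1 \<and> q - \<alpha> dvd p - 1) \<or> (\<alpha> = 2 * p \<and> q - \<alpha> dvd p - 1)"
    (is "_ \<longleftrightarrow> ?A \<or> ?B") for \<alpha>
  proof -
    have "(\<alpha> \<in> (\<Union>d \<in> {d. d > 0 \<and> d dvd q - 1}. \<Union>\<epsilon> \<in> {-1, 1}.
        if s - \<epsilon> * d dvd p - 1 then {p + \<epsilon> * d} else {})) \<longleftrightarrow>
      (\<exists>d>0. d dvd q - 1 \<and> (\<alpha> = p - d \<or> \<alpha> = p + d) \<and> q - \<alpha> dvd p - 1)"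
      unfolding s by (auto split: if_splits simp: algebra_simps)
    also have "\<dots> \<longleftrightarrow> ?A"
    proof
      assume A: ?A
      then have "p - \<alpha> \<noteq> 0"
        using p1 assms(3) by auto
      then show "\<exists>d>0. d dvd q - 1 \<and> (\<alpha> = p - d \<or> \<alpha> = p + d) \<and> q - \<alpha> dvd p - 1"
        using A by (intro exI[of _ "\<bar>p - \<alpha>\<bar>"]) auto
    qed auto
    finally have "(\<alpha> \<in> (\<Union>d \<in> {d. d > 0 \<and> d dvd q - 1}. \<Union>\<epsilon> \<in> {-1, 1}.
        if s - \<epsilon> * d dvd p - 1 then {p + \<epsilon> * d} else {})) \<longleftrightarrow> ?A" .
    moreover have "p - s dvd p - 1 \<longleftrightarrow> q - 2 * p dvd p - 1"
    proof -
      have "p - s = - (q - 2 * p)"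
        unfolding s by simp
      then show ?thesis
        by (metis minus_dvd_iff)
    qed
    ultimately show ?thesis
      unfolding Un_iff by auto
  qed
  have "\<alpha> \<in> Z_Korselt_set N \<longleftrightarrow> ?A \<alpha> \<or> ?B \<alpha>" for \<alpha>
  proof
    assume "\<alpha> \<in> Z_Korselt_set N"
    then have K: "\<alpha> \<noteq> 0" "\<alpha> \<noteq> p * q" "p - \<alpha> dvd p * (q - 1)" "q - \<alpha> dvd q * (p - 1)"
      using Z_Korselt_set_semiprime_iff[OF assms(1,2)] assms(4) by auto
    have "q - \<alpha> dvd p - 1"
      using q_minus_korselt_dvd[OF assms(1-3) K] .
    moreover have "p - \<alpha> dvd q - 1" if "\<alpha> \<noteq> 2 * p"
      using p_minus_korselt_dvd[OF assms(1,3) _ K(3) calculation that] assms(5,7) by simp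
    ultimately show "?A \<alpha> \<or> ?B \<alpha>"
      by blast
  next
    assume AB: "?A \<alpha> \<or> ?B \<alpha>"
    then have q_dvd: "q - \<alpha> dvd p - 1"
      by blast
    have p_dvd: "p - \<alpha> dvd p * (q - 1)"
      using AB by auto
    \<comment> \<open>The values \<open>0\<close> and \<open>p q\<close> lie at distance at least \<open>p\<close> from \<open>q\<close>.\<close>
    have near: "\<bar>q - \<alpha>\<bar> \<le> p - 1"
      using dvd_imp_le_int[OF _ q_dvd] p1 by simp
    have "\<alpha> \<noteq> 0"
      using near assms(3) p1 by auto
    moreover have "\<alpha> \<noteq> p * q"
    proof -
      have "2 * q \<le> p * q"
        using p1 assms(3) by (intro mult_right_mono) simp_all
      then show ?thesis
        using near assms(3) by linarith
    qed
    ultimately show "\<alpha> \<in> Z_Korselt_set N"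
      using Z_Korselt_set_semiprime_iff[OF assms(1,2)] assms(4) p_dvd q_dvd by auto
  qed
  with R show ?thesis
    by blast
qed

end
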